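(* Let $K_0=\dfrac{4\log 2-2}{\sqrt{3-4\log 2}}$ and define $\psi:\mathbb{R}\to\mathbb{R}$ by $$\psi(x)=K_0\,\sqrt2\sum_{k\in\mathbb{Z}}g_k\,\varphi(2x-k),\qquad g_k=(-1)^{k-1}h_{1-k},$$ where $\varphi$ is the modified Farey map and $h_1=h_{-1}=\dfrac{1}{3\sqrt2}$, $h_0=\dfrac{1}{\sqrt2}$, $h_k=0$ for $|k|\ge 2$. Then: (i) for all $\xi\in\mathbb{R}$, $\widehat{\psi}(\xi)=\mathcal{M}_1\!\left(\dfrac{\xi}{2}\right)\widehat{\varphi}\!\left(\dfrac{\xi}{2}\right)$, where $\mathcal{M}_1(\xi)=\dfrac{K_0}{6}\left(3-2\cos\xi\right)e^{-i\xi}$; (ii) $\|\psi\|_2^2=\displaystyle\int_{\mathbb{R}}|\psi(x)|^2\,dx=1$.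
   Context: $\log$ is the natural logarithm. The modified Farey map $\varphi:\mathbb{R}\to\mathbb{R}$ is $$\varphi(x)=\begin{cases}\dfrac{1}{4\log2-2}\,\dfrac{1+x}{1-x}, & -1\le x\le 0,\\[2mm] \dfrac{1}{4\log2-2}\,\dfrac{1-x}{1+x}, & 0\le x\le 1,\\[2mm] 0, & |x|>1.\end{cases}$$ The Fourier transform of an integrable function $f$ is $\widehat f(\xi)=\int_{\mathbb{R}}f(x)e^{-i\xi x}\,dx$. *)

theory Defs
  imports "HOL-Analysis.Analysis"
begin

definition farey :: "real \<Rightarrow> real" where
  "farey x =
    (if -1 \<le> x \<and> x \<le> 0 then 1 / (4 * ln 2 - 2) * ((1 + x) / (1 - x))
     else if 0 \<le> x \<and> x \<le> 1 then 1 / (4 * ln 2 - 2) * ((1 - x) / (1 + x))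
     else 0)"

text \<open>The Bochner integral is total, with value 0 when the integrand is not integrable;
  the definition has its intended meaning for integrable \<open>f\<close>.\<close>

definition fourier :: "(real \<Rightarrow> complex) \<Rightarrow> real \<Rightarrow> complex" where
  "fourier f \<xi> = (LINT x|lebesgue. f x * exp (- \<i> * of_real \<xi> * of_real x))"

definition L2_norm :: "(real \<Rightarrow> real) \<Rightarrow> real" where
  "L2_norm f = sqrt (LINT x|lebesgue. \<bar>f x\<bar>\<^sup>2)"

definition K0 :: real where
  "K0 = (4 * ln 2 - 2) / sqrt (3 - 4 * ln 2)"

definition h :: "int \<Rightarrow> real" where
  "h k = (if k = 1 \<or> k = -1 then 1 / (3 * sqrt 2) else if k = 0 then 1 / sqrt 2 else 0)"

definition g :: "int \<Rightarrow> real" where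
  "g k = (-1) powi (k - 1) * h (1 - k)"

definition psi :: "real \<Rightarrow> real" where
  "psi x = K0 * sqrt 2 * (\<Sum>\<^sub>\<infinity>k\<in>(UNIV :: int set). g k * farey (2 * x - of_int k))"

definition M1 :: "real \<Rightarrow> complex" where
  "M1 \<xi> = of_real (K0 / 6 * (3 - 2 * cos \<xi>)) * exp (- \<i> * of_real \<xi>)"

end

theory Submission
  imports Defs
begin

text \<open>
  The sum defining \<open>psi\<close> has only three nonzero terms, so that
  \<open>psi x = K0 * (\<phi>(y) - (\<phi>(y + 1) + \<phi>(y - 1)) / 3)\<close> with \<open>y = 2 * x - 1\<close> and \<open>\<phi> = farey\<close>.

  Part (i) is then the rule that replacing \<open>x\<close> by \<open>2 * x - k\<close> multiplies the transform at \<open>\<xi> / 2\<close>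
  by \<open>exp (- \<i> \<xi> k / 2) / 2\<close>: the three exponentials for \<open>k = 0, 1, 2\<close> combine into
  \<open>exp (- \<i> \<xi> / 2)\<close> times a multiple of \<open>3 - 2 * cos (\<xi> / 2)\<close>.

  For part (ii), expand the square. Only the autocorrelations of \<open>\<phi>\<close> at the lags 0, 1 and 2 occur.
  Lag 2 contributes nothing, since the supports meet in one point at most. Partial fractions give
  \<open>2 * c\<close> at lag 0 and \<open>c / 3\<close> at lag 1, for the same constant
  \<open>c = (3 - 4 * ln 2) / (4 * ln 2 - 2)\<^sup>2\<close>. Hence the mixed terms \<open>- 2 * (2/3) * (c / 3)\<close> cancel the
  contribution \<open>(2/9) * (2 * c)\<close> of the two outer squares, leaving \<open>2 * c\<close>. The substitution
  \<open>y = 2 * x - 1\<close> halves this, and \<open>K0\<close> is chosen so that \<open>K0\<^sup>2 * c = 1\<close>.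
\<close>

section \<open>The modified Farey map\<close>

text \<open>As a single formula in \<open>\<bar>x\<bar>\<close>, the Farey map is visibly even and continuous.\<close>

lemma farey_eq_max: "farey x = 1 / (4 * ln 2 - 2) * max 0 ((1 - \<bar>x\<bar>) / (1 + \<bar>x\<bar>))"
proof (cases "\<bar>x\<bar> \<le> 1")
  case True
  then have "max 0 ((1 - \<bar>x\<bar>) / (1 + \<bar>x\<bar>)) = (1 - \<bar>x\<bar>) / (1 + \<bar>x\<bar>)"
    by (intro max_absorb2 divide_nonneg_pos) auto
  with True show ?thesis by (auto simp: farey_def abs_if)
next
  case False
  then have "(1 - \<bar>x\<bar>) / (1 + \<bar>x\<bar>) \<le> 0" by (intro divide_nonpos_pos) auto
  with False show ?thesis by (auto simp: farey_def max_absorb1)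
qed

lemma farey_minus: "farey (- x) = farey x"
  by (simp add: farey_eq_max)

lemma farey_eq_0: "\<bar>x\<bar> \<ge> 1 \<Longrightarrow> farey x = 0"
  by (auto simp: farey_def)

lemma farey_unit_interval: "0 \<le> x \<Longrightarrow> x \<le> 1 \<Longrightarrow> farey x = (1 - x) / (1 + x) / (4 * ln 2 - 2)"
  by (auto simp: farey_def)

lemma continuous_on_farey: "continuous_on UNIV farey"
  unfolding farey_eq_max[abs_def] by (intro continuous_intros) auto

lemma borel_measurable_farey [measurable]: "farey \<in> borel_measurable borel"
  by (rule borel_measurable_continuous_onI[OF continuous_on_farey])

lemma integrable_farey: "integrable lborel farey"
proof -
  have "integrable lborel (\<lambda>x. indicator {-1..1} x *\<^sub>R farey x)"
    by (rule borel_integrable_compact) (auto intro: continuous_on_subset[OF continuous_on_farey])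
  also have "(\<lambda>x. indicator {-1..1} x *\<^sub>R farey x) = farey"
    by (rule ext) (auto simp: indicator_def farey_def)
  finally show ?thesis .
qed

section \<open>Autocorrelations of the Farey map\<close>

lemma has_bochner_integral_farey_square_half:
  "has_bochner_integral lborel (\<lambda>x. (farey x)\<^sup>2 * indicator {0..1} x)
     ((3 - 4 * ln 2) / (4 * ln 2 - 2)\<^sup>2)"
proof -
  let ?a = "4 * ln 2 - 2 :: real"
  \<comment> \<open>On the unit interval \<open>(1 - x) / (1 + x) = 2 / (1 + x) - 1\<close>; square and integrate termwise.\<close>
  let ?F = "\<lambda>x::real. (x - 4 / (1 + x) - 4 * ln (1 + x)) / ?a\<^sup>2"
  have "has_bochner_integral lborel (\<lambda>x. (farey x)\<^sup>2 * indicator {0..1} x) (?F 1 - ?F 0)"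
  proof (rule has_bochner_integral_FTC_Icc_real[where F = ?F])
    fix x :: real assume x: "0 \<le> x" "x \<le> 1"
    have "1 - 4 * (- 1 / (1 + x)\<^sup>2) - 4 * (1 / (1 + x)) = ((1 - x) / (1 + x))\<^sup>2"
      using x by (simp add: divide_simps) (simp add: power2_eq_square algebra_simps)
    then have "((1 - 4 * (- 1 / (1 + x)\<^sup>2) - 4 * (1 / (1 + x))) / ?a\<^sup>2) = (farey x)\<^sup>2"
      using x by (simp add: farey_unit_interval power_divide power_mult_distrib)
    moreover have "(?F has_real_derivative
        ((1 - 4 * (- 1 / (1 + x)\<^sup>2) - 4 * (1 / (1 + x))) / ?a\<^sup>2)) (at x)"
      using x by (intro DERIV_cdivide) (auto intro!: derivative_eq_intros simp: power2_eq_square)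
    ultimately show "(?F has_real_derivative (farey x)\<^sup>2) (at x)"
      by simp
  next
    fix x :: real
    show "isCont (\<lambda>x. (farey x)\<^sup>2) x"
      using continuous_on_farey by (auto simp: continuous_on_eq_continuous_at)
  qed auto
  also have "?F 1 - ?F 0 = (3 - 4 * ln 2) / ?a\<^sup>2"
    by (simp add: diff_divide_distrib add_divide_distrib)
  finally show ?thesis .
qed

lemma has_bochner_integral_farey_square:
  "has_bochner_integral lborel (\<lambda>x. (farey x)\<^sup>2) (2 * ((3 - 4 * ln 2) / (4 * ln 2 - 2)\<^sup>2))"
proof -
  let ?c = "(3 - 4 * ln 2) / (4 * ln 2 - 2)\<^sup>2 :: real"
  let ?f = "\<lambda>x. (farey x)\<^sup>2 * indicator {0..1} x"
  have "has_bochner_integral lborel (\<lambda>x. ?f (0 + (-1) * x)) (?c /\<^sub>R \<bar>-1\<bar>)"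
    using has_bochner_integral_farey_square_half
    by (subst lborel_has_bochner_integral_real_affine_iff[symmetric]) auto
  with has_bochner_integral_farey_square_half
  have "has_bochner_integral lborel (\<lambda>x. ?f x + ?f (0 + (-1) * x)) (?c + ?c /\<^sub>R \<bar>-1\<bar>)"
    by (rule has_bochner_integral_add)
  moreover have "AE x in lborel. ?f x + ?f (0 + (-1) * x) = (farey x)\<^sup>2"
    \<comment> \<open>At the origin both halves count.\<close>
    using AE_lborel_singleton[of 0]
  proof eventually_elim
    case (elim x)
    then show ?case
      using farey_eq_0[of x] by (cases "\<bar>x\<bar> \<le> 1") (auto simp: indicator_def farey_minus)
  qed
  ultimately show ?thesis
    by (subst (asm) has_bochner_integral_cong_AE[where g = "\<lambda>x. (farey x)\<^sup>2"]) auto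
qed

lemma has_bochner_integral_farey_lag_1:
  "has_bochner_integral lborel (\<lambda>x. farey x * farey (x - 1))
     ((3 - 4 * ln 2) / (4 * ln 2 - 2)\<^sup>2 / 3)"
proof -
  let ?a = "4 * ln 2 - 2 :: real"
  \<comment> \<open>The supports overlap in the unit interval, where up to normalization the factors are
    \<open>2 / (1 + x) - 1\<close> and \<open>2 / (2 - x) - 1\<close>; expand the product and use
    \<open>4 / ((1 + x) * (2 - x)) = (4/3) * (1 / (1 + x) + 1 / (2 - x))\<close>.\<close>
  let ?F = "\<lambda>x::real. (x - 2/3 * ln (1 + x) + 2/3 * ln (2 - x)) / ?a\<^sup>2"
  have "has_bochner_integral lborel (\<lambda>x. (farey x * farey (x - 1)) * indicator {0..1} x) (?F 1 - ?F 0)"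
  proof (rule has_bochner_integral_FTC_Icc_real[where F = ?F])
    fix x :: real assume x: "0 \<le> x" "x \<le> 1"
    have "farey (x - 1) = farey (1 - x)"
      using farey_minus[of "1 - x"] by simp
    also have "\<dots> = x / (2 - x) / ?a"
      using x by (simp add: farey_unit_interval)
    finally have "farey x * farey (x - 1) = ((1 - x) / (1 + x) * (x / (2 - x))) / ?a\<^sup>2"
      using x by (simp add: farey_unit_interval power2_eq_square)
    also have "(1 - x) / (1 + x) * (x / (2 - x)) = 1 - 2/3 * (1 / (1 + x)) + 2/3 * (- 1 / (2 - x))"
      using x by (simp add: divide_simps) (simp add: algebra_simps)
    finally have "farey x * farey (x - 1) =
      (1 - 2/3 * (1 / (1 + x)) + 2/3 * (- 1 / (2 - x))) / ?a\<^sup>2" .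
    moreover have "(?F has_real_derivative
        ((1 - 2/3 * (1 / (1 + x)) + 2/3 * (- 1 / (2 - x))) / ?a\<^sup>2)) (at x)"
      using x by (intro DERIV_cdivide)
        (auto intro!: derivative_eq_intros simp: divide_simps, simp add: algebra_simps)
    ultimately show "(?F has_real_derivative (farey x * farey (x - 1))) (at x)"
      by simp
  next
    fix x :: real
    have "continuous_on UNIV (\<lambda>x. farey x * farey (x - 1))"
      by (intro continuous_intros continuous_on_farey continuous_on_compose2[OF continuous_on_farey]) auto
    then show "isCont (\<lambda>x. farey x * farey (x - 1)) x"
      by (auto simp: continuous_on_eq_continuous_at)
  qed auto
  also have "(\<lambda>x. (farey x * farey (x - 1)) * indicator {0..1} x) = (\<lambda>x. farey x * farey (x - 1))"
  proof
    fix x :: real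
    show "(farey x * farey (x - 1)) * indicator {0..1} x = farey x * farey (x - 1)"
      using farey_eq_0[of x] farey_eq_0[of "x - 1"] by (cases "x < 0"; cases "x > 1") auto
  qed
  also have "?F 1 - ?F 0 = (3 - 4 * ln 2) / ?a\<^sup>2 / 3"
    by (simp add: diff_divide_distrib add_divide_distrib)
  finally show ?thesis .
qed

text \<open>The open supports of the two factors are \<open>(-2, 0)\<close> and \<open>(0, 2)\<close>.\<close>

lemma farey_lag_2: "farey (x + 1) * farey (x - 1) = 0"
  using farey_eq_0[of "x + 1"] farey_eq_0[of "x - 1"] by (cases "x \<ge> 0") auto

lemma has_bochner_integral_lborel_shift:
  fixes f :: "real \<Rightarrow> real"
  assumes "has_bochner_integral lborel f I"
  shows "has_bochner_integral lborel (\<lambda>x. f (x + t)) I"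
  using assms lborel_has_bochner_integral_real_affine_iff[of 1 f I t] by (simp add: add.commute)

section \<open>The wavelet as a combination of three Farey maps\<close>

definition farey_comb :: "real \<Rightarrow> real" where
  "farey_comb y = farey y - (farey (y + 1) + farey (y - 1)) / 3"

lemma psi_eq_three_terms:
  "psi x = K0 * (farey (2 * x - 1) - (farey (2 * x) + farey (2 * x - 2)) / 3)"
proof -
  have "(\<Sum>\<^sub>\<infinity>k\<in>(UNIV :: int set). g k * farey (2 * x - of_int k))
      = (\<Sum>\<^sub>\<infinity>k\<in>{0, 1, 2::int}. g k * farey (2 * x - of_int k))"
    by (rule infsum_cong_neutral) (auto simp: g_def h_def)
  also have "\<dots> = g 0 * farey (2 * x) + g 1 * farey (2 * x - 1) + g 2 * farey (2 * x - 2)"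
    by simp
  also have "\<dots> = (farey (2 * x - 1) - (farey (2 * x) + farey (2 * x - 2)) / 3) / sqrt 2"
    by (simp add: g_def h_def diff_divide_distrib add_divide_distrib)
  finally show ?thesis
    by (simp add: psi_def)
qed

lemma psi_eq_farey_comb: "psi x = K0 * farey_comb (2 * x - 1)"
  by (simp add: psi_eq_three_terms farey_comb_def)

lemma borel_measurable_psi [measurable]: "psi \<in> borel_measurable borel"
  unfolding psi_eq_three_terms[abs_def] by measurable

lemma has_bochner_integral_farey_comb_square:
  "has_bochner_integral lborel (\<lambda>y. (farey_comb y)\<^sup>2) (2 * ((3 - 4 * ln 2) / (4 * ln 2 - 2)\<^sup>2))"
proof -
  let ?c = "(3 - 4 * ln 2) / (4 * ln 2 - 2)\<^sup>2 :: real"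
  have lag_cancel: "2 * c + (1/9 * (2 * c) + 1/9 * (2 * c)) - 2/3 * (c / 3) - 2/3 * (c / 3) = 2 * c"
    for c :: real
    by simp
  have sq: "has_bochner_integral lborel (\<lambda>y. (farey (y + t))\<^sup>2) (2 * ?c)" for t
    using has_bochner_integral_lborel_shift[OF has_bochner_integral_farey_square] .
  have lag: "has_bochner_integral lborel (\<lambda>y. farey (y + t) * farey (y + t - 1)) (?c / 3)" for t
    using has_bochner_integral_lborel_shift[OF has_bochner_integral_farey_lag_1] .
  have "has_bochner_integral lborel
     (\<lambda>y. (farey (y + 0))\<^sup>2 + (1/9 * (farey (y + 1))\<^sup>2 + 1/9 * (farey (y + (-1)))\<^sup>2)
        - 2/3 * (farey (y + 0) * farey (y + 0 - 1)) - 2/3 * (farey (y + 1) * farey (y + 1 - 1)))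
     (2 * ?c + (1/9 * (2 * ?c) + 1/9 * (2 * ?c)) - 2/3 * (?c / 3) - 2/3 * (?c / 3))"
    by (intro has_bochner_integral_add has_bochner_integral_diff has_bochner_integral_mult_right
        sq lag)
  also have "(\<lambda>y. (farey (y + 0))\<^sup>2 + (1/9 * (farey (y + 1))\<^sup>2 + 1/9 * (farey (y + (-1)))\<^sup>2)
        - 2/3 * (farey (y + 0) * farey (y + 0 - 1)) - 2/3 * (farey (y + 1) * farey (y + 1 - 1)))
     = (\<lambda>y. (farey_comb y)\<^sup>2)"
  proof
    fix y
    have "(farey_comb y)\<^sup>2 = (farey y)\<^sup>2 + (1/9 * (farey (y + 1))\<^sup>2 + 1/9 * (farey (y - 1))\<^sup>2)
        - 2/3 * (farey y * farey (y - 1)) - 2/3 * (farey (y + 1) * farey y)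
        + 2/9 * (farey (y + 1) * farey (y - 1))"
      by (simp add: farey_comb_def power2_eq_square field_simps)
    then show "(farey (y + 0))\<^sup>2 + (1/9 * (farey (y + 1))\<^sup>2 + 1/9 * (farey (y + (-1)))\<^sup>2)
        - 2/3 * (farey (y + 0) * farey (y + 0 - 1)) - 2/3 * (farey (y + 1) * farey (y + 1 - 1))
     = (farey_comb y)\<^sup>2"
      by (simp add: farey_lag_2)
  qed
  also have "2 * ?c + (1/9 * (2 * ?c) + 1/9 * (2 * ?c)) - 2/3 * (?c / 3) - 2/3 * (?c / 3) = 2 * ?c"
    by (rule lag_cancel)
  finally show ?thesis .
qed

section \<open>Normalization\<close>

lemma K0_squared: "K0\<^sup>2 * ((3 - 4 * ln 2) / (4 * ln 2 - 2)\<^sup>2) = 1"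
proof -
  have "3 - 4 * ln 2 > (0::real)" "4 * ln 2 - 2 > (0::real)"
    using ln2_le_25_over_36 ln2_ge_two_thirds by simp_all
  then show ?thesis
    by (simp add: K0_def power_divide)
qed

lemma psi_square_integral: "(LINT x|lebesgue. \<bar>psi x\<bar>\<^sup>2) = 1"
proof -
  let ?c = "(3 - 4 * ln 2) / (4 * ln 2 - 2)\<^sup>2 :: real"
  have half: "(2 * c) /\<^sub>R \<bar>2\<bar> = c" for c :: real
    by simp
  have "has_bochner_integral lborel (\<lambda>x. (farey_comb (- 1 + 2 * x))\<^sup>2) ((2 * ?c) /\<^sub>R \<bar>2\<bar>)"
    using has_bochner_integral_farey_comb_square
    by (subst lborel_has_bochner_integral_real_affine_iff[symmetric]) auto
  then have "has_bochner_integral lborel (\<lambda>x. K0\<^sup>2 * (farey_comb (- 1 + 2 * x))\<^sup>2)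
      (K0\<^sup>2 * ((2 * ?c) /\<^sub>R \<bar>2\<bar>))"
    by (intro has_bochner_integral_mult_right)
  also have "(\<lambda>x. K0\<^sup>2 * (farey_comb (- 1 + 2 * x))\<^sup>2) = (\<lambda>x. \<bar>psi x\<bar>\<^sup>2)"
    by (simp add: psi_eq_farey_comb power_mult_distrib algebra_simps)
  also have "K0\<^sup>2 * ((2 * ?c) /\<^sub>R \<bar>2\<bar>) = 1"
    unfolding half by (rule K0_squared)
  finally show ?thesis
    by (simp add: integral_completion has_bochner_integral_integral_eq)
qed

section \<open>Fourier transforms\<close>

lemma fourier_eq_lborel:
  assumes [measurable]: "f \<in> borel_measurable borel"
  shows "fourier f \<xi> = (LINT x|lborel. f x * exp (- \<i> * of_real \<xi> * of_real x))"
  unfolding fourier_def by (rule integral_completion) measurable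

lemma fourier_dilate_shift:
  assumes [measurable]: "f \<in> borel_measurable borel"
  shows "fourier (\<lambda>x. f (2 * x - k)) \<xi>
    = exp (- \<i> * of_real (\<xi> / 2) * of_real k) / 2 * fourier f (\<xi> / 2)"
proof -
  have "fourier f (\<xi> / 2) = \<bar>2\<bar> *\<^sub>R (LINT x|lborel. f (- k + 2 * x) *
      exp (- \<i> * of_real (\<xi> / 2) * of_real (- k + 2 * x)))"
    unfolding fourier_eq_lborel[OF assms] by (rule lborel_integral_real_affine) simp
  also have "(\<lambda>x. f (- k + 2 * x) * exp (- \<i> * of_real (\<xi> / 2) * of_real (- k + 2 * x)))
    = (\<lambda>x. exp (\<i> * of_real (\<xi> / 2) * of_real k) *
        (f (2 * x - k) * exp (- \<i> * of_real \<xi> * of_real x)))"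
    by (rule ext) (simp add: algebra_simps exp_add[symmetric] exp_diff exp_minus field_simps)
  also have "(LINT x|lborel. exp (\<i> * of_real (\<xi> / 2) * of_real k) *
        (f (2 * x - k) * exp (- \<i> * of_real \<xi> * of_real x)))
    = exp (\<i> * of_real (\<xi> / 2) * of_real k) * fourier (\<lambda>x. f (2 * x - k)) \<xi>"
    by (subst fourier_eq_lborel) auto
  finally show ?thesis
    by (simp add: exp_minus field_simps scaleR_conv_of_real)
qed

lemma integrable_fourier_integrand:
  assumes "integrable lborel f"
  shows "integrable lborel (\<lambda>x. f x * exp (- \<i> * of_real \<xi> * of_real x))"
proof (rule Bochner_Integration.integrable_bound[OF assms])
  show "(\<lambda>x. f x * exp (- \<i> * of_real \<xi> * of_real x)) \<in> borel_measurable lborel"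
    using assms by measurable
qed (simp add: norm_mult)

text \<open>The symbol of the filter: the outer exponentials lie symmetrically about the middle one,
  so factoring that one out leaves a constant and a cosine.\<close>

lemma M1_eq_exponentials:
  "M1 \<eta> = of_real (K0 / 2) * (exp (- \<i> * of_real \<eta> * 1)
     - (exp (- \<i> * of_real \<eta> * 0) + exp (- \<i> * of_real \<eta> * 2)) / 3)"
proof -
  let ?z = "exp (- \<i> * of_real \<eta>)"
  have z2: "exp (- \<i> * of_real \<eta> * 2) = ?z * ?z"
    by (simp add: exp_add[symmetric] algebra_simps)
  have "2 * of_real (cos \<eta>) = ?z + exp (\<i> * of_real \<eta>)"
    by (simp add: cos_of_real[symmetric] cos_exp_eq)
  then have "2 * of_real (cos \<eta>) * ?z = ?z * ?z + 1"
    by (simp add: distrib_right exp_add[symmetric])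
  moreover have "M1 \<eta> = of_real (K0 / 6) * (3 * ?z - 2 * of_real (cos \<eta>) * ?z)"
    by (simp add: M1_def algebra_simps)
  ultimately show ?thesis
    unfolding z2 by (simp add: field_simps)
qed

lemma fourier_psi:
  "fourier (\<lambda>x. complex_of_real (psi x)) \<xi>
    = M1 (\<xi> / 2) * fourier (\<lambda>x. complex_of_real (farey x)) (\<xi> / 2)"
proof -
  let ?e = "\<lambda>x. exp (- \<i> * of_real \<xi> * of_real x)"
  let ?f = "\<lambda>k x. complex_of_real (farey (2 * x - k))"
  have "integrable lborel (\<lambda>x. farey (2 * x - k))" for k
    using lborel_integrable_real_affine[OF integrable_farey, of 2 "- k"] by (simp add: algebra_simps)
  then have int: "integrable lborel (\<lambda>x. ?f k x * ?e x)" for k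
    by (intro integrable_fourier_integrand) simp
  have "fourier (\<lambda>x. complex_of_real (psi x)) \<xi> = (LINT x|lborel. of_real K0 *
      (?f 1 x * ?e x - (?f 0 x * ?e x + ?f 2 x * ?e x) / 3))"
    by (subst fourier_eq_lborel) (simp_all add: psi_eq_three_terms algebra_simps add_divide_distrib)
  also have "\<dots> = of_real K0 * ((LINT x|lborel. ?f 1 x * ?e x)
      - ((LINT x|lborel. ?f 0 x * ?e x) + (LINT x|lborel. ?f 2 x * ?e x)) / 3)"
    by (simp only: integral_mult_right_zero integral_divide_zero Bochner_Integration.integral_diff
        Bochner_Integration.integral_add Bochner_Integration.integrable_add integrable_divide int)
  also have "\<dots> = of_real K0 * (fourier (?f 1) \<xi> - (fourier (?f 0) \<xi> + fourier (?f 2) \<xi>) / 3)"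
    by (simp add: fourier_eq_lborel)
  also have "\<dots> = M1 (\<xi> / 2) * fourier (\<lambda>x. complex_of_real (farey x)) (\<xi> / 2)"
    unfolding M1_eq_exponentials
    by (subst (1 2 3) fourier_dilate_shift[where f = "\<lambda>x. complex_of_real (farey x)"])
       (simp_all add: field_simps)
  finally show ?thesis .
qed

theorem theorem3p1:
  shows "(\<forall>\<xi>::real. fourier (\<lambda>x. complex_of_real (psi x)) \<xi>
            = M1 (\<xi> / 2) * fourier (\<lambda>x. complex_of_real (farey x)) (\<xi> / 2))
       \<and> (L2_norm psi)\<^sup>2 = (LINT x|lebesgue. \<bar>psi x\<bar>\<^sup>2)
       \<and> (LINT x|lebesgue. \<bar>psi x\<bar>\<^sup>2) = 1"
  using fourier_psi by (simp only: L2_norm_def psi_square_integral) simp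

end
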